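(* Let $t \geq s \geq 1$ be integers and let $G=C_3^tC_4^s$. Then $G$ is graceful when $t\equiv 0,1\pmod 4$ and near graceful when $t\equiv 2,3\pmod 4$.
   Context: $C_n^t$ denotes the union of $t$ cycles of length $n$ sharing exactly one common (central) vertex, and $C_3^tC_4^s$ denotes the graph obtained by identifying the central vertices of $C_3^t$ and $C_4^s$ (a windmill with $t$ triangle vanes and $s$ $4$-cycle vanes). For a graph $G$ with $m$ edges, a graceful labelling is an injective map $f:V(G)\to\{0,\ldots,m\}$ such that $g(uv)=|f(u)-f(v)|$ is a bijection $E(G)\to\{1,\ldots,m\}$. A near graceful labelling is an injective map $f:V(G)\to\{0,\ldots,m+1\}$ such that $g(uv)=|f(u)-f(v)|$ is a bijection onto $\{1,\ldots,m-1,m\}$ or onto $\{1,\ldots,m-1,m+1\}$. A graph is (near) graceful if it admits such a labelling. *)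

theory Defs
  imports Main
begin

text \<open>Undirected graphs are pairs of a vertex set and a set of two-element vertex sets.\<close>

type_synonym 'a graph = "'a set \<times> 'a set set"

abbreviation verts :: "'a graph \<Rightarrow> 'a set" where "verts G \<equiv> fst G"

abbreviation edges :: "'a graph \<Rightarrow> 'a set set" where "edges G \<equiv> snd G"

text \<open>\<open>Rim i j\<close> is the \<open>j\<close>-th vertex (\<open>0 < j < n\<close>) of the \<open>i\<close>-th cycle, counted from the
  central vertex, which is the vertex number 0 of every cycle.\<close>

datatype vertex = Centre | Rim nat nat

definition corner :: "nat \<Rightarrow> nat \<Rightarrow> vertex" where
  "corner i j = (if j = 0 then Centre else Rim i j)"

text \<open>\<open>cycles n t\<close> is $C_n^t$; it is meant for \<open>n \<ge> 3\<close>.\<close>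

definition cycles :: "nat \<Rightarrow> nat \<Rightarrow> vertex graph" where
  "cycles n t =
    (insert Centre {corner i j | i j. i < t \<and> j < n},
     {{corner i j, corner i (Suc j mod n)} | i j. i < t \<and> j < n})"

text \<open>\<open>identify c G d H\<close> is the disjoint union of \<open>G\<close> and \<open>H\<close> with the vertex \<open>c\<close> of \<open>G\<close> and the
  vertex \<open>d\<close> of \<open>H\<close> identified; the merged vertex is \<open>Inl c\<close>.\<close>

definition glue :: "'a \<Rightarrow> 'b \<Rightarrow> 'b \<Rightarrow> 'a + 'b" where
  "glue c d w = (if w = d then Inl c else Inr w)"

definition identify :: "'a \<Rightarrow> 'a graph \<Rightarrow> 'b \<Rightarrow> 'b graph \<Rightarrow> ('a + 'b) graph" where
  "identify c G d H =
    (Inl ` verts G \<union> glue c d ` verts H,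
     (\<lambda>e. Inl ` e) ` edges G \<union> (\<lambda>e. glue c d ` e) ` edges H)"

definition windmill :: "nat \<Rightarrow> nat \<Rightarrow> (vertex + vertex) graph" where
  "windmill t s = identify Centre (cycles 3 t) Centre (cycles 4 s)"

text \<open>The induced edge labelling maps the edge \<open>{u, v}\<close> to \<open>\<bar>f u - f v\<bar>\<close>; this determines it on
  \<open>edges G\<close>.\<close>

definition induces :: "'a graph \<Rightarrow> ('a \<Rightarrow> int) \<Rightarrow> ('a set \<Rightarrow> int) \<Rightarrow> bool" where
  "induces G f g \<longleftrightarrow> (\<forall>u v. {u, v} \<in> edges G \<longrightarrow> g {u, v} = \<bar>f u - f v\<bar>)"

definition graceful_labelling :: "'a graph \<Rightarrow> ('a \<Rightarrow> int) \<Rightarrow> bool" where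
  "graceful_labelling G f \<longleftrightarrow>
    (let m = int (card (edges G)) in
      inj_on f (verts G) \<and> f ` verts G \<subseteq> {0..m} \<and>
      (\<exists>g. induces G f g \<and> bij_betw g (edges G) {1..m}))"

definition near_graceful_labelling :: "'a graph \<Rightarrow> ('a \<Rightarrow> int) \<Rightarrow> bool" where
  "near_graceful_labelling G f \<longleftrightarrow>
    (let m = int (card (edges G)) in
      inj_on f (verts G) \<and> f ` verts G \<subseteq> {0..m + 1} \<and>
      (\<exists>g. induces G f g \<and>
        (bij_betw g (edges G) {1..m} \<or> bij_betw g (edges G) (insert (m + 1) {1..m - 1}))))"

definition graceful :: "'a graph \<Rightarrow> bool" where
  "graceful G \<longleftrightarrow> (\<exists>f. graceful_labelling G f)"

definition near_graceful :: "'a graph \<Rightarrow> bool" where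
  "near_graceful G \<longleftrightarrow> (\<exists>f. near_graceful_labelling G f)"

end

theory Submission
  imports Defs
begin

text \<open>
  Label the centre 0. A triangle labelled \<open>0, a, a + d\<close> has the edge labels \<open>a\<close>, \<open>a + d\<close> and \<open>d\<close>,
  so a (hooked) Skolem sequence of order \<open>t\<close> labels all triangles, with \<open>d\<close> running through
  \<open>1, \<dots>, t\<close>. The numbers \<open>1, \<dots>, t\<close> are then edge labels but not yet vertex labels; since
  \<open>s \<le> t\<close>, each \<open>d \<le> s\<close> can serve as the label of the vertex opposite to the centre in a 4-cycle
  \<open>0, b + d, d, c + d\<close>, whose edge labels are \<open>b + d\<close>, \<open>b\<close>, \<open>c\<close> and \<open>c + d\<close>. The pairs
  \<open>{b, b + d}\<close> and \<open>{c, c + d}\<close> come from two Skolem sequences of order \<open>s\<close> which together fill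
  \<open>t + 1, \<dots>, t + 4s\<close>; if only hooked sequences exist, one of them and its reversal interlock to
  fill this interval. The Skolem sequence for the triangles is placed above it, and if it is hooked,
  its gap leaves out exactly the label \<open>m = 3t + 4s\<close>.
\<close>

section \<open>Partitions into pairs with prescribed differences\<close>

text \<open>At most \<open>card S\<close> points that hit all of \<open>S\<close> can neither miss
  \<open>S\<close> nor repeat a value. So coverage and a count suffice, both for pair partitions and
  for edge labels.\<close>

lemma bij_betw_if_covers:
  assumes "finite D" and "S \<subseteq> h ` D" and "card D \<le> card S"
  shows "bij_betw h D S"
proof -
  have "card (h ` D) \<le> card D"
    using assms(1) by (rule card_image_le)
  then have "S = h ` D"
    using assms by (intro card_seteq) simp_all
  moreover from this \<open>card (h ` D) \<le> card D\<close> assms(1,3) have "inj_on h D"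
    by (intro eq_card_imp_inj_on) simp_all
  ultimately show ?thesis
    by (simp add: bij_betw_def)
qed

text \<open>A partition of \<open>S\<close> into pairs \<open>{a d, a d + d}\<close>, one for each difference \<open>d = 1, \<dots>, n\<close>.
  For \<open>S = {1..2n}\<close> this is a Skolem sequence and for \<open>S = {1..2n - 1} \<union> {2n + 1}\<close> a hooked Skolem
  sequence of order \<open>n\<close>.\<close>

definition skolem :: "nat \<Rightarrow> (int \<Rightarrow> int) \<Rightarrow> int set \<Rightarrow> bool" where
  "skolem n a S \<longleftrightarrow>
    bij_betw (\<lambda>(d, upper). if upper then a d + d else a d) ({1..int n} \<times> UNIV) S"

lemma skolemI:
  assumes "card S = 2 * n"
    and "\<And>p. p \<in> S \<Longrightarrow> \<exists>d\<in>{1..int n}. p = a d \<or> p = a d + d"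
  shows "skolem n a S"
  unfolding skolem_def
proof (rule bij_betw_if_covers)
  show "S \<subseteq> (\<lambda>(d, upper). if upper then a d + d else a d) ` ({1..int n} \<times> UNIV)"
  proof
    fix p assume "p \<in> S"
    then obtain d where "d \<in> {1..int n}" "p = a d \<or> p = a d + d"
      using assms(2) by blast
    then show "p \<in> (\<lambda>(d, upper). if upper then a d + d else a d) ` ({1..int n} \<times> UNIV)"
      by (auto intro: image_eqI[of _ _ "(d, False)"] image_eqI[of _ _ "(d, True)"])
  qed
qed (simp_all add: assms(1) card_cartesian_product)

lemma skolemD:
  assumes "skolem n a S"
  shows "d \<in> {1..int n} \<Longrightarrow> a d \<in> S" and "d \<in> {1..int n} \<Longrightarrow> a d + d \<in> S"
    and "\<lbrakk>d \<in> {1..int n}; d' \<in> {1..int n}; a d = a d'\<rbrakk> \<Longrightarrow> d = d'"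
    and "\<lbrakk>d \<in> {1..int n}; d' \<in> {1..int n}; a d + d = a d' + d'\<rbrakk> \<Longrightarrow> d = d'"
    and "\<lbrakk>d \<in> {1..int n}; d' \<in> {1..int n}\<rbrakk> \<Longrightarrow> a d \<noteq> a d' + d'"
    and "p \<in> S \<Longrightarrow> \<exists>d\<in>{1..int n}. p = a d \<or> p = a d + d"
    and "finite S" and "card S = 2 * n"
proof -
  let ?h = "\<lambda>(d, upper). if upper then a d + d else a d"
  let ?D = "{1..int n} \<times> (UNIV :: bool set)"
  have im: "S = ?h ` ?D" and inj: "inj_on ?h ?D"
    using assms by (auto simp: skolem_def bij_betw_def)
  show "d \<in> {1..int n} \<Longrightarrow> a d \<in> S" "d \<in> {1..int n} \<Longrightarrow> a d + d \<in> S"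
    unfolding im by force+
  show "p \<in> S \<Longrightarrow> \<exists>d\<in>{1..int n}. p = a d \<or> p = a d + d"
    unfolding im by (auto split: if_splits)
  show "\<lbrakk>d \<in> {1..int n}; d' \<in> {1..int n}; a d = a d'\<rbrakk> \<Longrightarrow> d = d'"
    using inj_onD[OF inj, of "(d, False)" "(d', False)"] by simp
  show "\<lbrakk>d \<in> {1..int n}; d' \<in> {1..int n}; a d + d = a d' + d'\<rbrakk> \<Longrightarrow> d = d'"
    using inj_onD[OF inj, of "(d, True)" "(d', True)"] by simp
  show "\<lbrakk>d \<in> {1..int n}; d' \<in> {1..int n}\<rbrakk> \<Longrightarrow> a d \<noteq> a d' + d'"
    using inj_onD[OF inj, of "(d, False)" "(d', True)"] by auto
  show "finite S"
    unfolding im by simp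
  show "card S = 2 * n"
    unfolding im by (simp add: card_image[OF inj] card_cartesian_product)
qed

lemma skolem_shift:
  assumes "skolem n a S"
  shows "skolem n (\<lambda>d. a d + K) ((\<lambda>x. x + K) ` S)"
proof -
  have "bij_betw (\<lambda>x. x + K) S ((\<lambda>x. x + K) ` S)"
    by (simp add: bij_betw_def inj_on_def)
  from bij_betw_trans[OF assms[unfolded skolem_def] this] show ?thesis
    unfolding skolem_def by (rule bij_betw_cong[THEN iffD1, rotated]) auto
qed

text \<open>Reflection swaps the ends of a pair: the new lower end is the image of the old upper end
  \<open>a d + d\<close>.\<close>

lemma skolem_reverse:
  assumes "skolem n a S"
  shows "skolem n (\<lambda>d. K - (a d + d)) ((\<lambda>x. K - x) ` S)"
proof (rule skolemI)
  show "card ((\<lambda>x. K - x) ` S) = 2 * n"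
    using skolemD(8)[OF assms] by (simp add: card_image inj_on_def)
  show "\<exists>d\<in>{1..int n}. p = K - (a d + d) \<or> p = K - (a d + d) + d" if "p \<in> (\<lambda>x. K - x) ` S" for p
    using that skolemD(6)[OF assms] by fastforce
qed

text \<open>The constructions nest even and odd differences separately: \<open>e j\<close> is the
  lower end for difference \<open>2 * j\<close>, \<open>o' j\<close> for \<open>2 * j + 1\<close>.
  The elimination form of \<open>cover\<close> lets a case analysis on the position name its
  pair.\<close>

lemma skolem_by_parityI:
  fixes e o' :: "int \<Rightarrow> int"
  assumes "card S = 2 * n"
    and cover: "\<And>p P. \<lbrakk>p \<in> S;
      \<And>j. \<lbrakk>1 \<le> j; 2 * j \<le> int n; p = e j \<or> p = e j + 2 * j\<rbrakk> \<Longrightarrow> P;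
      \<And>j. \<lbrakk>0 \<le> j; 2 * j + 1 \<le> int n; p = o' j \<or> p = o' j + 2 * j + 1\<rbrakk> \<Longrightarrow> P\<rbrakk> \<Longrightarrow> P"
  shows "\<exists>a. skolem n a S"
proof -
  let ?a = "\<lambda>d. if even d then e (d div 2) else o' (d div 2)"
  have "\<exists>d\<in>{1..int n}. p = ?a d \<or> p = ?a d + d" if "p \<in> S" for p
    using that
  proof (rule cover)
    fix j assume "1 \<le> j" "2 * j \<le> int n" "p = e j \<or> p = e j + 2 * j"
    then show ?thesis
      by (intro bexI[of _ "2 * j"]) auto
  next
    fix j assume "0 \<le> j" "2 * j + 1 \<le> int n" "p = o' j \<or> p = o' j + 2 * j + 1"
    then show ?thesis
      by (intro bexI[of _ "2 * j + 1"]) auto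
  qed
  then show ?thesis
    using skolemI[OF assms(1), of ?a] by blast
qed

section \<open>Explicit Skolem and hooked Skolem sequences by residue modulo 4\<close>

text \<open>The classical constructions of Skolem and O'Keefe: most pairs are nested symmetrically around a
  common midpoint, which yields all even or all odd differences in a range; the few exceptional
  pairs fill the remaining positions.\<close>

lemma skolem_exists_0_mod_4:
  assumes "k \<ge> 2"
  shows "\<exists>a. skolem (4 * k) a ({1..8 * int k})"
proof (rule skolem_by_parityI)
  let ?k = "int k"
  \<comment> \<open>The even pairs leave out their midpoint \<open>6 * ?k\<close>, which becomes the
    upper end for difference \<open>4 * ?k - 1\<close>. The odd pairs nest around
    \<open>2 * ?k + 1/2\<close> for \<open>j < ?k\<close> and around \<open>2 * ?k - 1/2\<close> for
    \<open>j > ?k\<close>. The exceptional indices \<open>0\<close>, \<open>?k - 1\<close>,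
    \<open>?k\<close>, \<open>2 * ?k - 1\<close> are distinct since
    \<open>k \<ge> 2\<close>.\<close>
  let ?e = "\<lambda>j. 6 * ?k - j"
  let ?o = "\<lambda>j. if j = 0 then ?k else if j = ?k then ?k - 1 else if j = ?k - 1 then 2 * ?k
    else if j = 2 * ?k - 1 then 2 * ?k + 1 else if j > ?k then 2 * ?k - 1 - j else 2 * ?k - j"
  fix p P
  assume p: "p \<in> {1..8 * int k}"
    and ev: "\<And>j. \<lbrakk>1 \<le> j; 2 * j \<le> int (4 * k); p = ?e j \<or> p = ?e j + 2 * j\<rbrakk> \<Longrightarrow> P"
    and od: "\<And>j. \<lbrakk>0 \<le> j; 2 * j + 1 \<le> int (4 * k); p = ?o j \<or> p = ?o j + 2 * j + 1\<rbrakk> \<Longrightarrow> P"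
  consider "1 \<le> p" "p \<le> ?k - 2"
    | "p = ?k - 1"
    | "?k \<le> p" "p \<le> ?k + 1"
    | "?k + 2 \<le> p" "p \<le> 2 * ?k - 1"
    | "p = 2 * ?k"
    | "p = 2 * ?k + 1"
    | "2 * ?k + 2 \<le> p" "p \<le> 3 * ?k - 1"
    | "p = 3 * ?k"
    | "3 * ?k + 1 \<le> p" "p \<le> 4 * ?k - 2"
    | "p = 4 * ?k - 1"
    | "4 * ?k \<le> p" "p \<le> 6 * ?k - 1"
    | "p = 6 * ?k"
    | "6 * ?k + 1 \<le> p" "p \<le> 8 * ?k"
    using p unfolding insert_iff atLeastAtMost_iff by (smt (verit))
  then show P
  proof cases
    case 1
    \<comment> \<open>In each case the index solves the equation of \<open>p\<close> with a lower or
      an upper end for \<open>j\<close>.\<close>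
    with assms od[of "2 * ?k - 1 - p"] show P
      by force
  next
    case 2
    with assms od[of "?k"] show P
      by force
  next
    case 3
    with assms od[of "0"] show P
      by force
  next
    case 4
    with assms od[of "2 * ?k - p"] show P
      by force
  next
    case 5
    with assms od[of "?k - 1"] show P
      by force
  next
    case 6
    with assms od[of "2 * ?k - 1"] show P
      by force
  next
    case 7
    with assms od[of "p - 2 * ?k - 1"] show P
      by force
  next
    case 8
    with assms od[of "?k"] show P
      by force
  next
    case 9
    with assms od[of "p - 2 * ?k"] show P
      by force
  next
    case 10
    with assms od[of "?k - 1"] show P
      by force
  next
    case 11
    with assms ev[of "6 * ?k - p"] show P
      by force
  next
    case 12
    with assms od[of "2 * ?k - 1"] show P
      by force
  next
    case 13
    with assms ev[of "p - 6 * ?k"] show P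
      by force
  qed
qed (use assms in auto)

lemma skolem_exists_1_mod_4:
  assumes "k \<ge> 2"
  shows "\<exists>a. skolem (4 * k + 1) a ({1..8 * int k + 2})"
proof (rule skolem_by_parityI)
  let ?k = "int k"
  \<comment> \<open>The even midpoint \<open>6 * ?k + 2\<close> is now the upper end for the largest
    difference \<open>4 * ?k + 1\<close>; indices \<open>0\<close> and \<open>?k - 1\<close> fill
    the positions left by the two odd nests.\<close>
  let ?e = "\<lambda>j. 6 * ?k + 2 - j"
  let ?o = "\<lambda>j. if j = 0 then ?k + 1 else if j = 2 * ?k then 2 * ?k + 1 else if j = ?k - 1 then 2 * ?k + 2
    else if j \<ge> ?k then 2 * ?k - j else 2 * ?k + 1 - j"
  fix p P
  assume p: "p \<in> {1..8 * int k + 2}"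
    and ev: "\<And>j. \<lbrakk>1 \<le> j; 2 * j \<le> int (4 * k + 1); p = ?e j \<or> p = ?e j + 2 * j\<rbrakk> \<Longrightarrow> P"
    and od: "\<And>j. \<lbrakk>0 \<le> j; 2 * j + 1 \<le> int (4 * k + 1); p = ?o j \<or> p = ?o j + 2 * j + 1\<rbrakk> \<Longrightarrow> P"
  consider "1 \<le> p" "p \<le> ?k"
    | "?k + 1 \<le> p" "p \<le> ?k + 2"
    | "?k + 3 \<le> p" "p \<le> 2 * ?k"
    | "p = 2 * ?k + 1"
    | "p = 2 * ?k + 2"
    | "2 * ?k + 3 \<le> p" "p \<le> 3 * ?k"
    | "3 * ?k + 1 \<le> p" "p \<le> 4 * ?k"
    | "p = 4 * ?k + 1"
    | "4 * ?k + 2 \<le> p" "p \<le> 6 * ?k + 1"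
    | "p = 6 * ?k + 2"
    | "6 * ?k + 3 \<le> p" "p \<le> 8 * ?k + 2"
    using p unfolding insert_iff atLeastAtMost_iff by (smt (verit))
  then show P
  proof cases
    case 1
    with assms od[of "2 * ?k - p"] show P
      by force
  next
    case 2
    with assms od[of "0"] show P
      by force
  next
    case 3
    with assms od[of "2 * ?k + 1 - p"] show P
      by force
  next
    case 4
    with assms od[of "2 * ?k"] show P
      by force
  next
    case 5
    with assms od[of "?k - 1"] show P
      by force
  next
    case 6
    with assms od[of "p - 2 * ?k - 2"] show P
      by force
  next
    case 7
    with assms od[of "p - 2 * ?k - 1"] show P
      by force
  next
    case 8
    with assms od[of "?k - 1"] show P
      by force
  next
    case 9
    with assms ev[of "6 * ?k + 2 - p"] show P
      by force
  next
    case 10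
    with assms od[of "2 * ?k"] show P
      by force
  next
    case 11
    with assms ev[of "p - 6 * ?k - 2"] show P
      by force
  qed
qed (use assms in auto)

lemma hooked_skolem_exists_2_mod_4:
  assumes "k \<ge> 1"
  shows "\<exists>a. skolem (4 * k + 2) a (insert (8 * int k + 5) {1..8 * int k + 3})"
proof (rule skolem_by_parityI)
  let ?k = "int k"
  \<comment> \<open>Here the even nest lies below the odd ones. The largest difference
    \<open>4 * ?k + 2\<close> jumps over the hole \<open>8 * ?k + 4\<close> to the hook.\<close>
  let ?e = "\<lambda>j. if j = 2 * ?k + 1 then 4 * ?k + 3 else 2 * ?k + 1 - j"
  let ?o = "\<lambda>j. if j = 2 * ?k then 2 * ?k + 1 else if j = ?k then 4 * ?k + 2 else if j = 0 then 7 * ?k + 3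
    else if j > ?k then 6 * ?k + 3 - j else 6 * ?k + 2 - j"
  fix p P
  assume p: "p \<in> insert (8 * int k + 5) {1..8 * int k + 3}"
    and ev: "\<And>j. \<lbrakk>1 \<le> j; 2 * j \<le> int (4 * k + 2); p = ?e j \<or> p = ?e j + 2 * j\<rbrakk> \<Longrightarrow> P"
    and od: "\<And>j. \<lbrakk>0 \<le> j; 2 * j + 1 \<le> int (4 * k + 2); p = ?o j \<or> p = ?o j + 2 * j + 1\<rbrakk> \<Longrightarrow> P"
  consider "1 \<le> p" "p \<le> 2 * ?k"
    | "p = 2 * ?k + 1"
    | "2 * ?k + 2 \<le> p" "p \<le> 4 * ?k + 1"
    | "p = 4 * ?k + 2"
    | "p = 4 * ?k + 3"
    | "4 * ?k + 4 \<le> p" "p \<le> 5 * ?k + 2"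
    | "5 * ?k + 3 \<le> p" "p \<le> 6 * ?k + 1"
    | "p = 6 * ?k + 2"
    | "p = 6 * ?k + 3"
    | "6 * ?k + 4 \<le> p" "p \<le> 7 * ?k + 2"
    | "7 * ?k + 3 \<le> p" "p \<le> 7 * ?k + 4"
    | "7 * ?k + 5 \<le> p" "p \<le> 8 * ?k + 3"
    | "p = 8 * ?k + 5"
    using p unfolding insert_iff atLeastAtMost_iff by (smt (verit))
  then show P
  proof cases
    case 1
    with assms ev[of "2 * ?k + 1 - p"] show P
      by force
  next
    case 2
    with assms od[of "2 * ?k"] show P
      by force
  next
    case 3
    with assms ev[of "p - 2 * ?k - 1"] show P
      by force
  next
    case 4
    with assms od[of "?k"] show P
      by force
  next
    case 5
    with assms ev[of "2 * ?k + 1"] show P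
      by force
  next
    case 6
    with assms od[of "6 * ?k + 3 - p"] show P
      by force
  next
    case 7
    with assms od[of "6 * ?k + 2 - p"] show P
      by force
  next
    case 8
    with assms od[of "2 * ?k"] show P
      by force
  next
    case 9
    with assms od[of "?k"] show P
      by force
  next
    case 10
    with assms od[of "p - 6 * ?k - 3"] show P
      by force
  next
    case 11
    with assms od[of "0"] show P
      by force
  next
    case 12
    with assms od[of "p - 6 * ?k - 4"] show P
      by force
  next
    case 13
    with assms ev[of "2 * ?k + 1"] show P
      by force
  qed
qed (use assms in auto)

lemma hooked_skolem_exists_3_mod_4:
  assumes "k \<ge> 2"
  shows "\<exists>a. skolem (4 * k - 1) a (insert (8 * int k - 1) {1..8 * int k - 3})"
proof (rule skolem_by_parityI)
  let ?k = "int k"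
  \<comment> \<open>The pairs inside \<open>{1..4 * ?k - 1}\<close> are those for order
    \<open>4 * k\<close>. Position \<open>2 * ?k + 1\<close> is instead joined to the even midpoint
    \<open>6 * ?k - 1\<close> by difference \<open>4 * ?k - 2\<close>, and the largest difference
    joins \<open>4 * ?k\<close> to the hook.\<close>
  let ?e = "\<lambda>j. if j = 2 * ?k - 1 then 2 * ?k + 1 else 6 * ?k - 1 - j"
  let ?o = "\<lambda>j. if j = 2 * ?k - 1 then 4 * ?k else if j = 0 then ?k else if j = ?k then ?k - 1
    else if j = ?k - 1 then 2 * ?k else if j > ?k then 2 * ?k - 1 - j else 2 * ?k - j"
  fix p P
  assume p: "p \<in> insert (8 * int k - 1) {1..8 * int k - 3}"
    and ev: "\<And>j. \<lbrakk>1 \<le> j; 2 * j \<le> int (4 * k - 1); p = ?e j \<or> p = ?e j + 2 * j\<rbrakk> \<Longrightarrow> P"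
    and od: "\<And>j. \<lbrakk>0 \<le> j; 2 * j + 1 \<le> int (4 * k - 1); p = ?o j \<or> p = ?o j + 2 * j + 1\<rbrakk> \<Longrightarrow> P"
  consider "1 \<le> p" "p \<le> ?k - 2"
    | "p = ?k - 1"
    | "?k \<le> p" "p \<le> ?k + 1"
    | "?k + 2 \<le> p" "p \<le> 2 * ?k - 1"
    | "p = 2 * ?k"
    | "p = 2 * ?k + 1"
    | "2 * ?k + 2 \<le> p" "p \<le> 3 * ?k - 1"
    | "p = 3 * ?k"
    | "3 * ?k + 1 \<le> p" "p \<le> 4 * ?k - 2"
    | "p = 4 * ?k - 1"
    | "p = 4 * ?k"
    | "4 * ?k + 1 \<le> p" "p \<le> 6 * ?k - 2"
    | "p = 6 * ?k - 1"
    | "6 * ?k \<le> p" "p \<le> 8 * ?k - 3"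
    | "p = 8 * ?k - 1"
    using p unfolding insert_iff atLeastAtMost_iff by (smt (verit))
  then show P
  proof cases
    case 1
    with assms od[of "2 * ?k - 1 - p"] show P
      by force
  next
    case 2
    with assms od[of "?k"] show P
      by force
  next
    case 3
    with assms od[of "0"] show P
      by force
  next
    case 4
    with assms od[of "2 * ?k - p"] show P
      by force
  next
    case 5
    with assms od[of "?k - 1"] show P
      by force
  next
    case 6
    with assms ev[of "2 * ?k - 1"] show P
      by force
  next
    case 7
    with assms od[of "p - 2 * ?k - 1"] show P
      by force
  next
    case 8
    with assms od[of "?k"] show P
      by force
  next
    case 9
    with assms od[of "p - 2 * ?k"] show P
      by force
  next
    case 10
    with assms od[of "?k - 1"] show P
      by force
  next
    case 11
    with assms od[of "2 * ?k - 1"] show P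
      by force
  next
    case 12
    with assms ev[of "6 * ?k - 1 - p"] show P
      by force
  next
    case 13
    with assms ev[of "2 * ?k - 1"] show P
      by force
  next
    case 14
    with assms ev[of "p - 6 * ?k + 1"] show P
      by force
  next
    case 15
    with assms od[of "2 * ?k - 1"] show P
      by force
  qed
qed (use assms in auto)

text \<open>These are the orders below the range of the general patterns, where exceptional indices
  would collide.\<close>

lemma skolem_small_orders:
  shows "\<exists>a. skolem 1 a {1..2}" and "\<exists>a. skolem 3 a (insert 7 {1..5})"
    and "\<exists>a. skolem 2 a (insert 5 {1..3})" and "\<exists>a. skolem 4 a {1..8}" and "\<exists>a. skolem 5 a {1..10}"
proof -
  have "{1..10::int} = {1, 2, 3, 4, 5, 6, 7, 8, 9, 10}" "{1..8::int} = {1, 2, 3, 4, 5, 6, 7, 8}"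
    "{1..5::int} = {1, 2, 3, 4, 5}" "{1..4::int} = {1, 2, 3, 4}" "{1..3::int} = {1, 2, 3}"
    "{1..2::int} = {1, 2}"
    by (simp_all add: set_eq_iff) presburger+
  note interval = this
  have "skolem 1 (\<lambda>_. 1) {1..2}"
    by (rule skolemI) (auto simp: interval)
  then show "\<exists>a. skolem 1 a {1..2}"
    by blast
  have "skolem 3 ((\<lambda>_. 0)(1 := 2, 2 := 5, 3 := 1)) (insert 7 {1..5})"
    by (rule skolemI) (auto simp: interval)
  then show "\<exists>a. skolem 3 a (insert 7 {1..5})"
    by blast
  have "skolem 2 ((\<lambda>_. 0)(1 := 1, 2 := 3)) (insert 5 {1..3})"
    by (rule skolemI) (auto simp: interval)
  then show "\<exists>a. skolem 2 a (insert 5 {1..3})"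
    by blast
  have "skolem 4 ((\<lambda>_. 0)(1 := 1, 2 := 4, 3 := 5, 4 := 3)) {1..8}"
    by (rule skolemI) (auto simp: interval)
  then show "\<exists>a. skolem 4 a {1..8}"
    by blast
  have "skolem 5 ((\<lambda>_. 0)(1 := 1, 2 := 7, 3 := 3, 4 := 4, 5 := 5)) {1..10}"
    by (rule skolemI) (auto simp: interval)
  then show "\<exists>a. skolem 5 a {1..10}"
    by blast
qed

section \<open>Existence for every order, and two interlocking sequences\<close>

lemma skolem_exists:
  assumes "n mod 4 \<in> {0, 1}" and "n > 0"
  shows "\<exists>a. skolem n a {1..2 * int n}"
proof (cases "n \<in> {1, 4, 5}")
  case True
  then consider "n = 1" | "n = 4" | "n = 5"
    by blast
  then show ?thesis
    by cases (simp_all add: skolem_small_orders[simplified])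
next
  case False
  define k where "k = n div 4"
  then consider "n = 4 * k" | "n = 4 * k + 1"
    using assms(1) div_mult_mod_eq[of n 4] by fastforce
  then show ?thesis
  proof cases
    case 1
    with False assms(2) have "k \<ge> 2" "2 * int n = 8 * int k"
      by auto
    with 1 show ?thesis
      using skolem_exists_0_mod_4[of k] by metis
  next
    case 2
    with False have "k \<ge> 2" "2 * int n = 8 * int k + 2"
      by auto
    with 2 show ?thesis
      using skolem_exists_1_mod_4[of k] by metis
  qed
qed

lemma hooked_skolem_exists:
  assumes "n mod 4 \<in> {2, 3}"
  shows "\<exists>a. skolem n a (insert (2 * int n + 1) {1..2 * int n - 1})"
proof (cases "n \<in> {2, 3}")
  case True
  then consider "n = 2" | "n = 3"
    by blast
  then show ?thesis
    by cases (simp_all add: skolem_small_orders[simplified])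
next
  case False
  define k where "k = n div 4"
  then consider "n = 4 * k + 2" | "n = 4 * k + 3"
    using assms(1) div_mult_mod_eq[of n 4] by fastforce
  then show ?thesis
  proof cases
    case 1
    with False have "k \<ge> 1" "2 * int n + 1 = 8 * int k + 5" "2 * int n - 1 = 8 * int k + 3"
      by auto
    with 1 show ?thesis
      using hooked_skolem_exists_2_mod_4[of k] by metis
  next
    case 2
    \<comment> \<open>The construction for residue 3 is indexed from above, by
      \<open>4 * k - 1\<close>, hence the shift to \<open>k + 1\<close>.\<close>
    with False have "k + 1 \<ge> 2" "2 * int n + 1 = 8 * int (k + 1) - 1"
      "2 * int n - 1 = 8 * int (k + 1) - 3" "n = 4 * (k + 1) - 1"
      by auto
    then show ?thesis
      using hooked_skolem_exists_3_mod_4[of "k + 1"] by metis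
  qed
qed

text \<open>A 4-cycle whose opposite vertex is labelled \<open>d\<close> uses two disjoint pairs of
  difference \<open>d\<close>. Two Skolem sequences can simply be juxtaposed; for hooked ones,
  \<open>K + 2 * int n\<close> and \<open>K + 2 * int n + 1\<close> are each the hole of one copy
  and the hook of the other.\<close>

lemma twofold_skolem_exists:
  fixes K :: int
  assumes "n > 0"
  obtains b c B C where "skolem n b B" "skolem n c C" "B \<inter> C = {}" "B \<union> C = {K + 1..K + 4 * int n}"
proof (cases "n mod 4 \<in> {0, 1}")
  case True
  then obtain a where "skolem n a {1..2 * int n}"
    using skolem_exists[OF True assms] by blast
  from skolem_shift[OF this, of K] skolem_shift[OF this, of "K + 2 * int n"] show thesis
    unfolding image_insert image_add_atLeastAtMost' image_diff_atLeastAtMost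
    by (rule that) auto
next
  case False
  then have "n mod 4 \<in> {2, 3}"
    by auto
  then obtain a where "skolem n a (insert (2 * int n + 1) {1..2 * int n - 1})"
    using hooked_skolem_exists by blast
  \<comment> \<open>The last element of the first sequence fills the hole of the reversed copy.\<close>
  from skolem_shift[OF this, of K] skolem_reverse[OF this, of "K + 4 * int n + 1"]
  show thesis
    unfolding image_insert image_add_atLeastAtMost' image_diff_atLeastAtMost
    by (rule that) (use assms in auto)
qed

section \<open>The labelling and the edges of the windmill\<close>

text \<open>\<open>Inr Centre\<close> is not a vertex of the windmill, so its label is arbitrary.\<close>

definition windmill_label :: "(int \<Rightarrow> int) \<Rightarrow> (int \<Rightarrow> int) \<Rightarrow> (int \<Rightarrow> int) \<Rightarrow> vertex + vertex \<Rightarrow> int" where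
  "windmill_label a b c v = (case v of
      Inl Centre \<Rightarrow> 0
    | Inl (Rim i j) \<Rightarrow> (let d = int i + 1 in if j = 1 then a d else a d + d)
    | Inr Centre \<Rightarrow> 0
    | Inr (Rim i j) \<Rightarrow> (let d = int i + 1 in
        if j = 1 then b d + d else if j = 2 then d else c d + d))"

text \<open>An upper bound serves here because injectivity and the range of labels pass to
  subsets.\<close>

lemma verts_windmill_subset:
  "verts (windmill t s) \<subseteq> insert (Inl Centre)
     ({Inl (Rim i j) | i j. i < t \<and> j \<in> {1, 2}} \<union> {Inr (Rim i j) | i j. i < s \<and> j \<in> {1, 2, 3}})"
  by (auto simp: windmill_def identify_def cycles_def glue_def corner_def)

lemma edges_windmill:
  "edges (windmill t s) =
     (\<lambda>(i, j). {Inl (corner i j), Inl (corner i (Suc j mod 3))}) ` ({..<t} \<times> {..<3}) \<union>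
     (\<lambda>(i, j). glue Centre Centre ` {corner i j, corner i (Suc j mod 4)}) ` ({..<s} \<times> {..<4})"
proof -
  have "edges (cycles n r) = (\<lambda>(i, j). {corner i j, corner i (Suc j mod n)}) ` ({..<r} \<times> {..<n})" for n r
    by (auto simp: cycles_def)
  then show ?thesis
    by (simp add: windmill_def identify_def image_image case_prod_unfold)
qed

lemma finite_edges_windmill: "finite (edges (windmill t s))"
  by (simp add: edges_windmill)

text \<open>Coinciding edges are not excluded at this point; equality follows once the edges are
  seen to realize \<open>3 * t + 4 * s\<close> different labels.\<close>

lemma card_edges_windmill_le: "card (edges (windmill t s)) \<le> 3 * t + 4 * s"
  unfolding edges_windmill
  by (intro card_Un_le[THEN order_trans] add_mono card_image_le[THEN order_trans])
     (simp_all add: card_cartesian_product)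

lemma triangle_edges_windmill:
  assumes "i < t"
  shows "{Inl Centre, Inl (Rim i 1)} \<in> edges (windmill t s)"
    and "{Inl (Rim i 1), Inl (Rim i 2)} \<in> edges (windmill t s)"
    and "{Inl (Rim i 2), Inl Centre} \<in> edges (windmill t s)"
proof -
  have "{Inl (corner i j), Inl (corner i (Suc j mod 3))} \<in> edges (windmill t s)" if "j < 3" for j
    unfolding edges_windmill using assms that by force
  from this[of 0] this[of 1] this[of 2] show "{Inl Centre, Inl (Rim i 1)} \<in> edges (windmill t s)"
    "{Inl (Rim i 1), Inl (Rim i 2)} \<in> edges (windmill t s)"
    "{Inl (Rim i 2), Inl Centre} \<in> edges (windmill t s)"
    by (simp_all add: corner_def numeral_2_eq_2)
qed

lemma square_edges_windmill:
  assumes "i < s"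
  shows "{Inl Centre, Inr (Rim i 1)} \<in> edges (windmill t s)"
    and "{Inr (Rim i 1), Inr (Rim i 2)} \<in> edges (windmill t s)"
    and "{Inr (Rim i 2), Inr (Rim i 3)} \<in> edges (windmill t s)"
    and "{Inr (Rim i 3), Inl Centre} \<in> edges (windmill t s)"
proof -
  have "glue Centre Centre ` {corner i j, corner i (Suc j mod 4)} \<in> edges (windmill t s)" if "j < 4" for j
    unfolding edges_windmill using assms that by force
  note edge = this
  show "{Inl Centre, Inr (Rim i 1)} \<in> edges (windmill t s)"
    using edge[of 0] by (simp add: corner_def glue_def insert_commute)
  show "{Inr (Rim i 1), Inr (Rim i 2)} \<in> edges (windmill t s)"
    using edge[of 1] by (simp add: corner_def glue_def numeral_2_eq_2)
  show "{Inr (Rim i 2), Inr (Rim i 3)} \<in> edges (windmill t s)"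
    using edge[of 2] by (simp add: corner_def glue_def)
  show "{Inr (Rim i 3), Inl Centre} \<in> edges (windmill t s)"
    using edge[of 3] by (simp add: corner_def glue_def)
qed

section \<open>From difference pairs to a labelling\<close>

text \<open>The sets stay abstract so that \<open>A\<close> may be an interval or have a hook.
  Keeping all pairs above \<open>t\<close> reserves \<open>1, ..., t\<close> for the outer triangle
  edges and the vertices opposite to the centre.\<close>

lemma windmill_labelling:
  fixes a b c :: "int \<Rightarrow> int" and s t :: nat
  assumes a: "skolem t a A" and b: "skolem s b B" and c: "skolem s c C" and "s \<le> t"
    and BC: "B \<inter> C = {}" and A_BC: "A \<inter> (B \<union> C) = {}" and gt: "A \<union> (B \<union> C) \<subseteq> {int t<..}"
  obtains f g where "inj_on f (verts (windmill t s))"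
    and "f ` verts (windmill t s) \<subseteq> {0..int t} \<union> A \<union> (B \<union> C)"
    and "card (edges (windmill t s)) = 3 * t + 4 * s"
    and "induces (windmill t s) f g"
    and "bij_betw g (edges (windmill t s)) ({1..int t} \<union> A \<union> (B \<union> C))"
proof
  let ?f = "windmill_label a b c"
  \<comment> \<open>Maximum minus minimum gives the absolute difference as a function of the
    unordered edge.\<close>
  let ?g = "\<lambda>e. Max (?f ` e) - Min (?f ` e)"
  let ?E = "edges (windmill t s)"
  let ?T = "{1..int t} \<union> A \<union> (B \<union> C)"
  let ?V = "insert (Inl Centre)
     ({Inl (Rim i j) | i j. i < t \<and> j \<in> {1, 2}} \<union> {Inr (Rim i j) | i j. i < s \<and> j \<in> {1, 2, 3}})"
  \<comment> \<open>Lower and upper end of a pair, indexed by the vane: vane \<open>i\<close>,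
    counted from 0, carries difference \<open>i + 1\<close>.\<close>
  define l where "l h i = h (int i + 1)" for h :: "int \<Rightarrow> int" and i
  define u where "u h i = h (int i + 1) + (int i + 1)" for h :: "int \<Rightarrow> int" and i
  have f: "?f (Inl Centre) = 0" "?f (Inl (Rim i (Suc 0))) = l a i" "?f (Inl (Rim i 2)) = u a i"
    "?f (Inr (Rim i (Suc 0))) = u b i" "?f (Inr (Rim i 2)) = int i + 1" "?f (Inr (Rim i 3)) = u c i" for i
    by (simp_all add: windmill_label_def Let_def l_def u_def)
  have mem: "l h i \<in> S" "u h i \<in> S" if "skolem n h S" "i < n" for n h S i
    using skolemD(1,2)[OF that(1), of "int i + 1"] that(2) by (auto simp: l_def u_def)
  have inj: "l h i = l h j \<longleftrightarrow> i = j" "u h i = u h j \<longleftrightarrow> i = j" "l h i \<noteq> u h j" "u h i \<noteq> l h j"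
    if "skolem n h S" "i < n" "j < n" for n h S i j
    using skolemD(3-5)[OF that(1), of "int i + 1" "int j + 1"]
      skolemD(5)[OF that(1), of "int j + 1" "int i + 1"] that(2,3) by (auto simp: l_def u_def)
  have cover: "\<exists>i<n. x = l h i \<or> x = u h i" if h: "skolem n h S" and x: "x \<in> S" for n h S x
  proof -
    obtain d where "d \<in> {1..int n}" "x = h d \<or> x = h d + d"
      using skolemD(6)[OF h x] by blast
    then show ?thesis
      by (intro exI[of _ "nat (d - 1)"]) (auto simp: l_def u_def)
  qed
  have A: "l a i \<in> A" "u a i \<in> A" if "i < t" for i
    using mem[OF a that] .
  have B: "l b i \<in> B" "u b i \<in> B" if "i < s" for i
    using mem[OF b that] .
  have C: "l c i \<in> C" "u c i \<in> C" if "i < s" for i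
    using mem[OF c that] .
  show "?f ` verts (windmill t s) \<subseteq> {0..int t} \<union> A \<union> (B \<union> C)"
  proof -
    have "?f ` ?V \<subseteq> {0..int t} \<union> A \<union> (B \<union> C)"
      using A B C \<open>s \<le> t\<close> by (auto simp: f)
    then show ?thesis
      by (rule order_trans[OF image_mono[OF verts_windmill_subset]])
  qed
  have "inj_on ?f ?V"
  proof -
    have pos: "l a i > int t" "u a i > int t" if "i < t" for i
      using A[OF that] gt by auto
    have pos': "u b i > int t" "u c i > int t" if "i < s" for i
      using B[OF that] C[OF that] gt by auto
    \<comment> \<open>The opposite vertices get labels up to \<open>s \<le> t\<close>, below all
      labels taken from the pairs.\<close>
    have small: "int i + 1 \<le> int t" if "i < s" for i
      using that \<open>s \<le> t\<close> by simp
    have pos0: "l a i \<noteq> 0" "u a i \<noteq> 0" if "i < t" for i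
      using pos[OF that] by auto
    have pos0': "u b i \<noteq> 0" "u c i \<noteq> 0" if "i < s" for i
      using pos'[OF that] by auto
    have ne: "l a i \<noteq> int j + 1" "u a i \<noteq> int j + 1" "l a i \<noteq> u b j" "u a i \<noteq> u b j"
      "l a i \<noteq> u c j" "u a i \<noteq> u c j" if "i < t" "j < s" for i j
      using pos[OF that(1)] small[OF that(2)] A[OF that(1)] B(2)[OF that(2)] C(2)[OF that(2)] A_BC
      by auto
    have ne': "u b i \<noteq> int j + 1" "u c i \<noteq> int j + 1" "u b i \<noteq> u c j" if "i < s" "j < s" for i j
      using pos'[OF that(1)] small[OF that(2)] B(2)[OF that(1)] C(2)[OF that(2)] BC by auto
    show ?thesis
      unfolding inj_on_def
      by (auto simp: f pos0 pos0' pos0[symmetric] pos0'[symmetric] ne ne' ne[symmetric] ne'[symmetric]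
          inj[OF a] inj[OF b] inj[OF c])
  qed
  then show "inj_on ?f (verts (windmill t s))"
    using verts_windmill_subset by (rule inj_on_subset)
  have g: "?g {v, w} = \<bar>?f v - ?f w\<bar>" for v w
    by simp
  then show "induces (windmill t s) ?f ?g"
    by (simp add: induces_def)
  have card: "card ?T = 3 * t + 4 * s"
  proof -
    have fin: "finite A" "finite B" "finite C"
      using skolemD(7) a b c by blast+
    have disj: "{1..int t} \<inter> A = {}" "({1..int t} \<union> A) \<inter> (B \<union> C) = {}"
      using A_BC gt by fastforce+
    show ?thesis
      using fin skolemD(8)[OF a] skolemD(8)[OF b] skolemD(8)[OF c]
      by (simp add: card_Un_disjoint disj BC del: Int_Un_distrib Int_Un_distrib2)
  qed
  have "?T \<subseteq> ?g ` ?E"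
  proof
    fix x assume "x \<in> ?T"
    then consider "x \<in> {1..int t}" | "x \<in> A" | "x \<in> B" | "x \<in> C"
      by blast
    then show "x \<in> ?g ` ?E"
    proof cases
      case 1
      define i where "i = nat (x - 1)"
      with 1 have "i < t" "x = int i + 1"
        by auto
      then have "x = ?g {Inl (Rim i 1), Inl (Rim i 2)}"
        unfolding g by (simp add: f l_def u_def)
      then show ?thesis
        using triangle_edges_windmill(2)[OF \<open>i < t\<close>] by blast
    next
      case 2
      then obtain i where "i < t" "x = l a i \<or> x = u a i"
        using cover[OF a] by blast
      then have "x = ?g {Inl Centre, Inl (Rim i 1)} \<or> x = ?g {Inl (Rim i 2), Inl Centre}"
        unfolding g using 2 gt by (auto simp: f)
      then show ?thesis
        using triangle_edges_windmill(1,3)[OF \<open>i < t\<close>] by blast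
    next
      case 3
      then obtain i where "i < s" "x = l b i \<or> x = u b i"
        using cover[OF b] by blast
      \<comment> \<open>The spoke carries \<open>u b i\<close>; subtracting the opposite label
        \<open>int i + 1\<close> leaves \<open>l b i\<close> on the next edge.\<close>
      then have "x = ?g {Inr (Rim i 1), Inr (Rim i 2)} \<or> x = ?g {Inl Centre, Inr (Rim i 1)}"
        unfolding g using 3 gt by (auto simp: f l_def u_def)
      then show ?thesis
        using square_edges_windmill(1,2)[OF \<open>i < s\<close>] by blast
    next
      case 4
      then obtain i where "i < s" "x = l c i \<or> x = u c i"
        using cover[OF c] by blast
      then have "x = ?g {Inr (Rim i 2), Inr (Rim i 3)} \<or> x = ?g {Inr (Rim i 3), Inl Centre}"
        unfolding g using 4 gt by (auto simp: f l_def u_def)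
      then show ?thesis
        using square_edges_windmill(3,4)[OF \<open>i < s\<close>] by blast
    qed
  qed
  \<comment> \<open>At most \<open>3 * t + 4 * s\<close> edges cover that many labels, which gives
    bijectivity and then the exact edge count.\<close>
  from bij_betw_if_covers[OF finite_edges_windmill this] card card_edges_windmill_le[of t s]
  show "bij_betw ?g ?E ?T"
    by simp
  then show "card ?E = 3 * t + 4 * s"
    using bij_betw_same_card card by metis
qed

section \<open>Placing the triangle sequence above the 4-cycle block\<close>

theorem theorem4p1:
  fixes t s :: nat
  assumes "t \<ge> s" and "s \<ge> 1"
  shows "(t mod 4 \<in> {0, 1} \<longrightarrow> graceful (windmill t s)) \<and>
         (t mod 4 \<in> {2, 3} \<longrightarrow> near_graceful (windmill t s))"
proof (intro conjI impI)
  from assms(2) have "s > 0"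
    by simp
  then obtain b c B C where bc: "skolem s b B" "skolem s c C" "B \<inter> C = {}"
    and BC: "B \<union> C = {int t + 1..int t + 4 * int s}"
    by (rule twofold_skolem_exists)
  let ?m = "3 * int t + 4 * int s"
  \<comment> \<open>The 4-cycle block ends at \<open>?K\<close>, and
    \<open>?m = ?K + 2 * int t\<close>.\<close>
  let ?K = "int t + 4 * int s"
  {
    assume "t mod 4 \<in> {0, 1}"
    then obtain a where "skolem t a {1..2 * int t}"
      using skolem_exists assms by fastforce
    from skolem_shift[OF this, of ?K] have a: "skolem t (\<lambda>d. a d + ?K) {?K + 1..?m}"
      by (simp add: image_add_atLeastAtMost' algebra_simps)
    obtain f g where fg: "inj_on f (verts (windmill t s))"
      "f ` verts (windmill t s) \<subseteq> {0..int t} \<union> {?K + 1..?m} \<union> (B \<union> C)"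
      "card (edges (windmill t s)) = 3 * t + 4 * s" "induces (windmill t s) f g"
      "bij_betw g (edges (windmill t s)) ({1..int t} \<union> {?K + 1..?m} \<union> (B \<union> C))"
      using a bc(1,2) assms(1) bc(3) by (rule windmill_labelling) (unfold BC, auto)
    have "{0..int t} \<union> {?K + 1..?m} \<union> (B \<union> C) = {0..?m}"
      "{1..int t} \<union> {?K + 1..?m} \<union> (B \<union> C) = {1..?m}"
      unfolding BC by auto
    with fg show "graceful (windmill t s)"
      unfolding graceful_def graceful_labelling_def Let_def by auto
  }
  {
    assume t: "t mod 4 \<in> {2, 3}"
    then obtain a where "skolem t a (insert (2 * int t + 1) {1..2 * int t - 1})"
      using hooked_skolem_exists by blast
    \<comment> \<open>The shift moves the hole \<open>2 * int t\<close> to \<open>?m\<close> and the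
      hook to \<open>?m + 1\<close>, giving the second form of near gracefulness.\<close>
    from skolem_shift[OF this, of ?K]
    have a: "skolem t (\<lambda>d. a d + ?K) (insert (?m + 1) {?K + 1..?m - 1})"
      by (simp add: image_add_atLeastAtMost' algebra_simps)
    obtain f g where fg: "inj_on f (verts (windmill t s))"
      "f ` verts (windmill t s) \<subseteq> {0..int t} \<union> insert (?m + 1) {?K + 1..?m - 1} \<union> (B \<union> C)"
      "card (edges (windmill t s)) = 3 * t + 4 * s" "induces (windmill t s) f g"
      "bij_betw g (edges (windmill t s)) ({1..int t} \<union> insert (?m + 1) {?K + 1..?m - 1} \<union> (B \<union> C))"
      using a bc(1,2) assms(1) bc(3) by (rule windmill_labelling) (unfold BC, auto)
    have "{0..int t} \<union> insert (?m + 1) {?K + 1..?m - 1} \<union> (B \<union> C) \<subseteq> {0..?m + 1}"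
      unfolding BC by auto
    with fg(2) have "f ` verts (windmill t s) \<subseteq> {0..?m + 1}"
      by (rule order_trans)
    moreover have "{1..int t} \<union> insert (?m + 1) {?K + 1..?m - 1} \<union> (B \<union> C) = insert (?m + 1) {1..?m - 1}"
      unfolding BC using assms by auto
    with fg(5) have "bij_betw g (edges (windmill t s)) (insert (?m + 1) {1..?m - 1})"
      by simp
    moreover have "int (card (edges (windmill t s))) = ?m"
      using fg(3) by simp
    ultimately have "near_graceful_labelling (windmill t s) f"
      unfolding near_graceful_labelling_def Let_def using fg(1,4) by metis
    then show "near_graceful (windmill t s)"
      unfolding near_graceful_def by blast
  }
qed

end
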